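(* Consider the optimal control problem (the sub-Riemannian nilpotent problem $(2,3,5,8)$) of minimizing $$\frac{1}{2}\int_a^b \left(u_1(t)^2+u_2(t)^2\right)dt$$ subject to $$\dot x_1=u_1,\quad \dot x_2=u_2,\quad \dot x_3=u_2x_1,\quad \dot x_4=\tfrac12 u_2x_1^2,$$ $$\dot x_5=u_2x_1x_2,\quad \dot x_6=\tfrac16 u_2x_1^3,\quad \dot x_7=\tfrac12 u_2x_1^2x_2,\quad \dot x_8=\tfrac12 u_2x_1x_2^2,$$ with state $(x_1,\dots,x_8)\in\mathbb{R}^8$ and control $(u_1,u_2)\in\mathbb{R}^2$. Then the following eight functions are independent first integrals of the problem, i.e. each of them is constant in $t$ along every normal Pontryagin extremal (normalized by $\psi_0=-1$), and the eight functions are functionally independent as functions of $(x_1,\dots,x_8,\psi_1,\dots,\psi_8)\in\mathbb{R}^{16}$: $$\psi_3,\quad \psi_4,\quad \psi_5,\quad \psi_6,\quad \psi_7,\quad \psi_8,\quad \psi_2+x_3\psi_5+x_4\psi_7+x_5\psi_8,\quad H,$$ where $H$ is the Hamiltonian evaluated at the extremal controls, that is, $$H=\frac12\psi_1^2+\frac12\left(\psi_2+\psi_3x_1+\tfrac12\psi_4x_1^2+\psi_5x_1x_2+\tfrac16\psi_6x_1^3+\tfrac12\psi_7x_1^2x_2+\tfrac12\psi_8x_1x_2^2\right)^2 .$$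
   Context: For an optimal control problem of minimizing $\int_a^b L(t,\mathbf{x}(t),\mathbf{u}(t))\,dt$ subject to $\dot{\mathbf{x}}(t)=\boldsymbol{\varphi}(t,\mathbf{x}(t),\mathbf{u}(t))$ (with no external forces), the Hamiltonian is $H(t,\mathbf{x},\mathbf{u},\psi_0,\boldsymbol{\psi})=\psi_0L(t,\mathbf{x},\mathbf{u})+\boldsymbol{\psi}^{\mathrm T}\cdot\boldsymbol{\varphi}(t,\mathbf{x},\mathbf{u})$. A (Pontryagin) extremal is a quadruple $(\mathbf{x}(\cdot),\mathbf{u}(\cdot),\psi_0,\boldsymbol{\psi}(\cdot))$, with $\mathbf{u}$ piecewise continuous, $\psi_0\le 0$ constant, $\boldsymbol{\psi}$ piecewise $C^1$ and $(\psi_0,\boldsymbol\psi)$ non-vanishing, satisfying almost everywhere on $[a,b]$ the Hamiltonian system $\dot{\mathbf{x}}^{\mathrm T}=\partial H/\partial\boldsymbol{\psi}$, $\dot{\boldsymbol{\psi}}^{\mathrm T}=-\partial H/\partial\mathbf{x}$ and the maximality condition $H(t,\mathbf{x}(t),\mathbf{u}(t),\psi_0,\boldsymbol{\psi}(t))=\max_{\mathbf{v}\in\Omega}H(t,\mathbf{x}(t),\mathbf{v},\psi_0,\boldsymbol{\psi}(t))$, where $\Omega$ is the (open) control set; here $\Omega=\mathbb{R}^2$. The extremal is normal when $\psi_0\neq0$. Functional independence means that the differentials of the functions are linearly independent at every point of an open dense subset of $\mathbb{R}^{16}$. *)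

theory Defs
  imports "HOL-Analysis.Analysis"
begin

definition piecewise_continuous :: "real \<Rightarrow> real \<Rightarrow> (real \<Rightarrow> 'a::topological_space) \<Rightarrow> bool" where
  "piecewise_continuous a b u \<longleftrightarrow>
     (\<exists>S. finite S \<and> continuous_on ({a..b} - S) u) \<and>
     (\<forall>t\<in>{a..<b}. \<exists>l. (u \<longlongrightarrow> l) (at_right t)) \<and>
     (\<forall>t\<in>{a<..b}. \<exists>l. (u \<longlongrightarrow> l) (at_left t))"

text \<open>
  Optimal control problems: minimize the integral of \<open>L t (x t) (u t)\<close> over \<open>{a..b}\<close> subject to
  \<open>x' t = \<phi> t (x t) (u t)\<close> and \<open>u t \<in> \<Omega>\<close>.
\<close>

definition hamiltonian ::
    "(real \<Rightarrow> 'x::real_inner \<Rightarrow> 'u \<Rightarrow> real) \<Rightarrow> (real \<Rightarrow> 'x \<Rightarrow> 'u \<Rightarrow> 'x) \<Rightarrow>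
     real \<Rightarrow> 'x \<Rightarrow> 'u \<Rightarrow> real \<Rightarrow> 'x \<Rightarrow> real" where
  "hamiltonian L \<phi> t x u \<psi>0 \<psi> = \<psi>0 * L t x u + \<psi> \<bullet> \<phi> t x u"

text \<open>
  The partial derivatives of the Hamiltonian are expressed by gradients (\<open>GDERIV\<close>).
  If \<open>\<phi>\<close> and the gradients of \<open>L\<close> and \<open>\<phi>\<close> in the state are continuous, then the Hamiltonian
  system makes \<open>x'\<close> and \<open>\<psi>'\<close> inherit one-sided limits from \<open>u\<close>; so nothing is lost in using
  \<open>piecewise_C1_differentiable_on\<close>, which does not ask for such limits.
\<close>

definition pontryagin_extremal ::
    "(real \<Rightarrow> 'x::euclidean_space \<Rightarrow> 'u::euclidean_space \<Rightarrow> real) \<Rightarrow> (real \<Rightarrow> 'x \<Rightarrow> 'u \<Rightarrow> 'x) \<Rightarrow>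
     'u set \<Rightarrow> real \<Rightarrow> real \<Rightarrow>
     (real \<Rightarrow> 'x) \<Rightarrow> (real \<Rightarrow> 'u) \<Rightarrow> real \<Rightarrow> (real \<Rightarrow> 'x) \<Rightarrow> bool" where
  "pontryagin_extremal L \<phi> \<Omega> a b x u \<psi>0 \<psi> \<longleftrightarrow>
     x piecewise_C1_differentiable_on {a..b} \<and>
     piecewise_continuous a b u \<and> (\<forall>t\<in>{a..b}. u t \<in> \<Omega>) \<and>
     \<psi>0 \<le> 0 \<and>
     \<psi> piecewise_C1_differentiable_on {a..b} \<and>
     (\<forall>t\<in>{a..b}. \<not> (\<psi>0 = 0 \<and> \<psi> t = 0)) \<and>
     (AE t in lborel. t \<in> {a..b} \<longrightarrow>
        (\<exists>v. (GDERIV (\<lambda>p. hamiltonian L \<phi> t (x t) (u t) \<psi>0 p) (\<psi> t) :> v) \<and>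
             (x has_vector_derivative v) (at t within {a..b})) \<and>
        (\<exists>w. (GDERIV (\<lambda>y. hamiltonian L \<phi> t y (u t) \<psi>0 (\<psi> t)) (x t) :> w) \<and>
             (\<psi> has_vector_derivative - w) (at t within {a..b})) \<and>
        (\<forall>v\<in>\<Omega>. hamiltonian L \<phi> t (x t) v \<psi>0 (\<psi> t) \<le> hamiltonian L \<phi> t (x t) (u t) \<psi>0 (\<psi> t)))"

text \<open>Normal extremals are normalized by \<open>\<psi>0 = -1\<close>.\<close>

definition first_integral ::
    "(real \<Rightarrow> 'x::euclidean_space \<Rightarrow> 'u::euclidean_space \<Rightarrow> real) \<Rightarrow> (real \<Rightarrow> 'x \<Rightarrow> 'u \<Rightarrow> 'x) \<Rightarrow>
     'u set \<Rightarrow> real \<Rightarrow> real \<Rightarrow> ('x \<times> 'x \<Rightarrow> real) \<Rightarrow> bool" where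
  "first_integral L \<phi> \<Omega> a b F \<longleftrightarrow>
     (\<forall>x u \<psi>. pontryagin_extremal L \<phi> \<Omega> a b x u (- 1) \<psi> \<longrightarrow>
        (\<lambda>t. F (x t, \<psi> t)) constant_on {a..b})"

text \<open>
  Linear independence of the differentials is that of an indexed family; equal differentials at
  different positions of the list count as dependent.
\<close>

definition functionally_independent :: "('a::euclidean_space \<Rightarrow> real) list \<Rightarrow> bool" where
  "functionally_independent Fs \<longleftrightarrow>
     (\<exists>U. open U \<and> closure U = UNIV \<and>
        (\<forall>z\<in>U.
           (\<forall>i<length Fs. (Fs ! i) differentiable (at z)) \<and>
           (\<forall>c :: nat \<Rightarrow> real.
              (\<forall>h. (\<Sum>i<length Fs. c i * frechet_derivative (Fs ! i) (at z) h) = 0) \<longrightarrow>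
              (\<forall>i<length Fs. c i = 0))))"

text \<open>The sub-Riemannian nilpotent problem \<open>(2,3,5,8)\<close>. In the index type \<open>8\<close>, \<open>8 = 0\<close>.\<close>

definition L2358 :: "real \<Rightarrow> real^8 \<Rightarrow> real^2 \<Rightarrow> real" where
  "L2358 t x u = 1/2 * ((u$1)\<^sup>2 + (u$2)\<^sup>2)"

definition phi2358 :: "real \<Rightarrow> real^8 \<Rightarrow> real^2 \<Rightarrow> real^8" where
  "phi2358 t x u = vector
     [u$1,
      u$2,
      u$2 * x$1,
      1/2 * u$2 * (x$1)^2,
      u$2 * x$1 * x$2,
      1/6 * u$2 * (x$1)^3,
      1/2 * u$2 * (x$1)^2 * x$2,
      1/2 * u$2 * x$1 * (x$2)^2]"

definition H2358 :: "(real^8) \<times> (real^8) \<Rightarrow> real" where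
  "H2358 = (\<lambda>(x, \<psi>).
     1/2 * (\<psi>$1)^2 +
     1/2 * (\<psi>$2 + \<psi>$3 * x$1 + 1/2 * \<psi>$4 * (x$1)^2 + \<psi>$5 * x$1 * x$2 + 1/6 * \<psi>$6 * (x$1)^3
            + 1/2 * \<psi>$7 * (x$1)^2 * x$2 + 1/2 * \<psi>$8 * x$1 * (x$2)^2)^2)"

definition integrals2358 :: "((real^8) \<times> (real^8) \<Rightarrow> real) list" where
  "integrals2358 =
     [\<lambda>(x, \<psi>). \<psi>$3,
      \<lambda>(x, \<psi>). \<psi>$4,
      \<lambda>(x, \<psi>). \<psi>$5,
      \<lambda>(x, \<psi>). \<psi>$6,
      \<lambda>(x, \<psi>). \<psi>$7,
      \<lambda>(x, \<psi>). \<psi>$8,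
      \<lambda>(x, \<psi>). \<psi>$2 + x$3 * \<psi>$5 + x$4 * \<psi>$7 + x$5 * \<psi>$8,
      H2358]"

end

theory Submission
  imports Defs
begin

text \<open>
  Write \<open>h2 x \<psi>\<close> for the coefficient of \<open>u$2\<close> in the Hamiltonian; the coefficient of \<open>u$1\<close> is \<open>\<psi>$1\<close>.
  For \<open>\<psi>0 = -1\<close> the Hamiltonian is a concave quadratic in the control, and completing the square
  shows that \<open>u = (\<psi>$1, h2 x \<psi>)\<close> is its only maximizer and \<open>H2358\<close> its maximal value
  (\<open>hamiltonian_2358_eq\<close>, \<open>maximizing_control\<close>). Normal extremals therefore satisfy, almost
  everywhere, the autonomous system \<open>x' = xvel\<close>, \<open>\<psi>' = pvel\<close> on \<open>\<real>\<^sup>8 \<times> \<real>\<^sup>8\<close> with polynomial right-hand side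
  (\<open>extremal_flow\<close>).

  A differentiable function whose differential annihilates \<open>(xvel, pvel)\<close> is constant along such curves
  (\<open>constant_on_derivative_along_AE_flow\<close>). The point to settle is the exceptional null set, which
  by itself would allow a Cantor function. An extremal is piecewise \<open>C\<^sup>1\<close>, so on the open set left after
  removing finitely many points both sides of the differential equation are continuous; where they differ
  is an open null set, hence empty. Only finitely many exceptional points remain, and the mean value
  theorem tolerates these.

  That the eight differentials annihilate the field is algebra (\<open>differentials2358_flow\<close>). The state enters
  the Hamiltonian only through \<open>x$1\<close> and \<open>x$2\<close>, which makes \<open>\<psi>$3, \<dots>, \<psi>$8\<close> constant; with these constant,
  \<open>\<psi>$2' = - h2 * \<partial>h2/\<partial>x2\<close> is minus the derivative of \<open>x$3 * \<psi>$5 + x$4 * \<psi>$7 + x$5 * \<psi>$8\<close>; and \<open>H2358\<close> is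
  conserved because the field is its Hamiltonian vector field.

  For independence, differentiate in the momentum directions. Modulo \<open>d\<psi>$3, \<dots>, d\<psi>$8\<close>
  the seventh differential is \<open>d\<psi>$2\<close> and \<open>dH\<close> has the component \<open>\<psi>$1 d\<psi>$1\<close>, so the system is triangular
  wherever \<open>\<psi>$1 \<noteq> 0\<close>, which is an open dense set.
\<close>

section \<open>Curves satisfying a differential equation almost everywhere\<close>

text \<open>The set of disagreement is open and null, and nonempty open sets have positive measure.\<close>

lemma AE_imp_all_continuous_on_open:
  fixes f g :: "'a::euclidean_space \<Rightarrow> 'b::real_normed_vector"
  assumes "open T" and f: "continuous_on T f" and g: "continuous_on T g"
    and ae: "AE t in lborel. t \<in> T \<longrightarrow> f t = g t" and "t \<in> T"
  shows "f t = g t"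
proof -
  define N where "N = (\<lambda>t. f t - g t) -` (- {0}) \<inter> T"
  have "continuous_on T (\<lambda>t. f t - g t)"
    by (intro continuous_intros f g)
  with \<open>open T\<close> have "open N"
    unfolding N_def by (metis continuous_on_open_vimage open_Compl closed_singleton)
  moreover have "AE t in lborel. t \<notin> N"
    using ae by eventually_elim (auto simp: N_def)
  ultimately have "N \<in> null_sets lborel"
    by (subst AE_iff_null_sets) auto
  then have "negligible N"
    by (simp add: negligible_iff_null_sets null_sets_completionI)
  with \<open>open N\<close> have "N = {}"
    using open_not_negligible by blast
  with \<open>t \<in> T\<close> show ?thesis
    by (auto simp: N_def)
qed

text \<open>
  Piecewise continuity of the derivative is what reduces an exceptional null set to a finite one.
\<close>

lemma piecewise_C1_AE_has_vector_derivative: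
  fixes f :: "real \<Rightarrow> 'a::real_normed_vector"
  assumes "f piecewise_C1_differentiable_on {a..b}" and V: "continuous_on {a..b} V"
    and ae: "AE t in lborel. t \<in> {a..b} \<longrightarrow> (f has_vector_derivative V t) (at t within {a..b})"
  obtains S where "finite S" and "\<And>t. t \<in> {a..b} - S \<Longrightarrow> (f has_vector_derivative V t) (at t)"
proof -
  obtain S D where S: "finite S" and cD: "continuous_on ({a..b} - S) D"
    and D: "\<And>t. t \<in> {a..b} - S \<Longrightarrow> (f has_vector_derivative D t) (at t)"
    using assms(1) unfolding piecewise_C1_differentiable_on_def C1_differentiable_on_def by blast
  \<comment> \<open>The endpoints are dropped to make \<open>T\<close> open and the derivative within \<open>{a..b}\<close> two-sided.\<close>
  define T where "T = {a<..<b} - S"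
  have "open T"
    unfolding T_def using S by (intro open_Diff finite_imp_closed) auto
  have "D t = V t" if "t \<in> T" for t
  proof (rule AE_imp_all_continuous_on_open[OF \<open>open T\<close> _ _ _ that])
    show "continuous_on T D" "continuous_on T V"
      by (rule continuous_on_subset[OF cD] continuous_on_subset[OF V]; auto simp: T_def)+
    show "AE t in lborel. t \<in> T \<longrightarrow> D t = V t"
      using ae
    proof eventually_elim
      case (elim t)
      show ?case
      proof
        assume t: "t \<in> T"
        then have "at t within {a..b} = at t"
          by (intro at_within_interior) (auto simp: T_def)
        with elim t have "(f has_vector_derivative V t) (at t)"
          by (auto simp: T_def)
        moreover have "(f has_vector_derivative D t) (at t)"
          using D t by (auto simp: T_def)
        ultimately show "D t = V t"
          by (metis vector_derivative_unique_at)
      qed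
    qed
  qed
  then have "(f has_vector_derivative V t) (at t)" if "t \<in> {a..b} - (S \<union> {a, b})" for t
    using D[of t] that by (auto simp: T_def)
  with S show thesis
    by (intro that[of "S \<union> {a, b}"]) auto
qed

lemma constant_on_derivative_along_AE_flow:
  fixes x :: "real \<Rightarrow> 'a::real_normed_vector" and p :: "real \<Rightarrow> 'b::real_normed_vector"
    and F :: "'a \<times> 'b \<Rightarrow> real"
  assumes x: "x piecewise_C1_differentiable_on {a..b}"
    and p: "p piecewise_C1_differentiable_on {a..b}"
    and V: "continuous_on UNIV V" and W: "continuous_on UNIV W"
    and x': "AE t in lborel. t \<in> {a..b} \<longrightarrow>
               (x has_vector_derivative V (x t, p t)) (at t within {a..b})"
    and p': "AE t in lborel. t \<in> {a..b} \<longrightarrow>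
               (p has_vector_derivative W (x t, p t)) (at t within {a..b})"
    and F: "\<And>z. (F has_derivative F' z) (at z)"
    and zero: "\<And>z. F' z (V z, W z) = 0"
  shows "(\<lambda>t. F (x t, p t)) constant_on {a..b}"
proof -
  have cz: "continuous_on {a..b} (\<lambda>t. (x t, p t))"
    using x p unfolding piecewise_C1_differentiable_on_def by (intro continuous_intros) auto
  note comp = continuous_on_compose2[OF _ cz subset_UNIV]
  obtain S where S: "finite S"
      "\<And>t. t \<in> {a..b} - S \<Longrightarrow> (x has_vector_derivative V (x t, p t)) (at t)"
    using piecewise_C1_AE_has_vector_derivative[OF x comp[OF V] x'] by blast
  obtain R where R: "finite R"
      "\<And>t. t \<in> {a..b} - R \<Longrightarrow> (p has_vector_derivative W (x t, p t)) (at t)"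
    using piecewise_C1_AE_has_vector_derivative[OF p comp[OF W] p'] by blast
  have cF: "continuous_on {a..b} (\<lambda>t. F (x t, p t))"
    by (rule comp) (meson F has_derivative_continuous continuous_at_imp_continuous_on)
  have "((\<lambda>t. F (x t, p t)) has_derivative (\<lambda>h. 0)) (at t within {a..b})"
    if t: "t \<in> {a..b} - (S \<union> R)" for t
  proof -
    have "((\<lambda>t. (x t, p t)) has_vector_derivative (V (x t, p t), W (x t, p t))) (at t)"
      using S(2) R(2) t by (intro has_vector_derivative_Pair) auto
    then have "((\<lambda>t. F (x t, p t)) has_derivative
                 (\<lambda>h. F' (x t, p t) (h *\<^sub>R (V (x t, p t), W (x t, p t))))) (at t)"
      unfolding has_vector_derivative_def using F by (rule has_derivative_compose)
    moreover have "F' z (h *\<^sub>R v) = h *\<^sub>R F' z v" for z h v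
      by (rule linear_cmul[OF has_derivative_linear[OF F]])
    ultimately have "((\<lambda>t. F (x t, p t)) has_derivative (\<lambda>h. 0)) (at t)"
      using zero by (simp del: scaleR_Pair)
    then show ?thesis
      by (rule has_derivative_at_withinI)
  qed
  then have "F (x t, p t) = F (x a, p a)" if "t \<in> {a..b}" for t
    using has_derivative_zero_unique_strong_interval[of "S \<union> R", OF _ cF refl _ that] S R by simp
  then show ?thesis
    unfolding constant_on_def by blast
qed

section \<open>Coordinates of \<open>\<real>\<^sup>8\<close>\<close>

lemma vector_8 [simp]:
  "(vector [a,b,c,d,e,f,g,h] :: 'a::zero^8)$1 = a"
  "(vector [a,b,c,d,e,f,g,h] :: 'a::zero^8)$2 = b"
  "(vector [a,b,c,d,e,f,g,h] :: 'a::zero^8)$3 = c"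
  "(vector [a,b,c,d,e,f,g,h] :: 'a::zero^8)$4 = d"
  "(vector [a,b,c,d,e,f,g,h] :: 'a::zero^8)$5 = e"
  "(vector [a,b,c,d,e,f,g,h] :: 'a::zero^8)$6 = f"
  "(vector [a,b,c,d,e,f,g,h] :: 'a::zero^8)$7 = g"
  "(vector [a,b,c,d,e,f,g,h] :: 'a::zero^8)$8 = h"
  unfolding vector_def by simp_all

lemma exhaust_8:
  fixes i :: 8
  shows "i = 1 \<or> i = 2 \<or> i = 3 \<or> i = 4 \<or> i = 5 \<or> i = 6 \<or> i = 7 \<or> i = 8"
proof (induct i)
  case (of_int z)
  then have "z = 0 \<or> z = 1 \<or> z = 2 \<or> z = 3 \<or> z = 4 \<or> z = 5 \<or> z = 6 \<or> z = 7"
    by simp arith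
  then show ?case
    by auto
qed

lemma forall_8:
  "(\<forall>i::8. P i) \<longleftrightarrow> P 1 \<and> P 2 \<and> P 3 \<and> P 4 \<and> P 5 \<and> P 6 \<and> P 7 \<and> P 8"
  by (metis exhaust_8)

lemma UNIV_8: "UNIV = {1, 2, 3, 4, 5, 6, 7, 8::8}"
  using exhaust_8 by auto

lemma sum_8: "sum f (UNIV::8 set) = f 1 + f 2 + f 3 + f 4 + f 5 + f 6 + f 7 + f 8"
  unfolding UNIV_8 by (simp add: ac_simps)

lemma inner_8:
  fixes x y :: "real^8"
  shows "x \<bullet> y = x$1 * y$1 + x$2 * y$2 + x$3 * y$3 + x$4 * y$4
               + x$5 * y$5 + x$6 * y$6 + x$7 * y$7 + x$8 * y$8"
  by (simp add: inner_vec_def sum_8)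

lemma continuous_on_vector_8:
  fixes f1 f2 f3 f4 f5 f6 f7 f8 :: "'a::topological_space \<Rightarrow> real"
  assumes "continuous_on S f1" "continuous_on S f2" "continuous_on S f3" "continuous_on S f4"
    "continuous_on S f5" "continuous_on S f6" "continuous_on S f7" "continuous_on S f8"
  shows "continuous_on S
    (\<lambda>z. vector [f1 z, f2 z, f3 z, f4 z, f5 z, f6 z, f7 z, f8 z] :: real^8)"
proof -
  let ?v = "\<lambda>z. vector [f1 z, f2 z, f3 z, f4 z, f5 z, f6 z, f7 z, f8 z] :: real^8"
  have "continuous_on S (\<lambda>z. ?v z $ i)" for i
    using exhaust_8[of i] assms by auto
  then have "continuous_on S (\<lambda>z. \<chi> i. ?v z $ i)"
    by (rule continuous_on_vec_lambda)
  then show ?thesis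
    by (simp only: vec_lambda_eta)
qed

lemma has_derivative_vec_nth [derivative_intros]:
  "(f has_derivative f') F \<Longrightarrow> ((\<lambda>x. f x $ i) has_derivative (\<lambda>h. f' h $ i)) F"
  by (rule bounded_linear.has_derivative[OF bounded_linear_vec_nth])

section \<open>The Hamiltonian system of the problem\<close>

text \<open>
  \<open>h2 x \<psi>\<close> is the pairing of \<open>\<psi>\<close> with the second controlled vector field, \<open>h2_x1\<close> and \<open>h2_x2\<close> are its partial
  derivatives in \<open>x$1\<close> and \<open>x$2\<close>.
\<close>

definition h2 :: "real^8 \<Rightarrow> real^8 \<Rightarrow> real" where
  "h2 x p = p$2 + p$3 * x$1 + 1/2 * p$4 * (x$1)^2 + p$5 * x$1 * x$2 + 1/6 * p$6 * (x$1)^3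
             + 1/2 * p$7 * (x$1)^2 * x$2 + 1/2 * p$8 * x$1 * (x$2)^2"

definition h2_x1 :: "real^8 \<Rightarrow> real^8 \<Rightarrow> real" where
  "h2_x1 x p = p$3 + p$4 * x$1 + p$5 * x$2 + 1/2 * p$6 * (x$1)^2 + p$7 * x$1 * x$2
              + 1/2 * p$8 * (x$2)^2"

definition h2_x2 :: "real^8 \<Rightarrow> real^8 \<Rightarrow> real" where
  "h2_x2 x p = p$5 * x$1 + 1/2 * p$7 * (x$1)^2 + p$8 * x$1 * x$2"

text \<open>
  The two components of the Hamiltonian vector field of \<open>H2358\<close>. The time argument \<open>0\<close> is arbitrary, as
  the dynamics are autonomous.
\<close>

definition xvel :: "(real^8) \<times> (real^8) \<Rightarrow> real^8" where
  "xvel = (\<lambda>(x, p). phi2358 0 x (vector [p$1, h2 x p]))"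

definition pvel :: "(real^8) \<times> (real^8) \<Rightarrow> real^8" where
  "pvel = (\<lambda>(x, p). vector [- h2 x p * h2_x1 x p, - h2 x p * h2_x2 x p, 0, 0, 0, 0, 0, 0])"

lemma continuous_on_xvel: "continuous_on UNIV xvel"
  unfolding xvel_def phi2358_def case_prod_beta h2_def vector_2
  by (intro continuous_on_vector_8 continuous_intros)

lemma continuous_on_pvel: "continuous_on UNIV pvel"
  unfolding pvel_def case_prod_beta h2_def h2_x1_def h2_x2_def
  by (intro continuous_on_vector_8 continuous_intros)

lemma inner_phi2358: "p \<bullet> phi2358 t x u = p$1 * u$1 + h2 x p * u$2"
  by (simp add: inner_8 phi2358_def h2_def algebra_simps)

text \<open>
  Completing the square exhibits both the maximizer over the controls and the maximum.
\<close>

lemma hamiltonian_2358_eq: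
  "hamiltonian L2358 phi2358 t x u (- 1) p =
     ((p$1)^2 + (h2 x p)^2 - ((u$1 - p$1)^2 + (u$2 - h2 x p)^2)) / 2"
  unfolding hamiltonian_def L2358_def inner_phi2358
  by (simp add: power2_eq_square algebra_simps)

lemma maximizing_control:
  assumes "\<forall>v\<in>UNIV. hamiltonian L2358 phi2358 t x v (- 1) p \<le> hamiltonian L2358 phi2358 t x u (- 1) p"
  shows "u = vector [p$1, h2 x p]"
proof -
  have gap: "d \<le> 0" if "(A - (0 + 0)) / 2 \<le> (A - d) / 2" for A d :: real
    using that by simp
  have "hamiltonian L2358 phi2358 t x (vector [p$1, h2 x p]) (- 1) p
      \<le> hamiltonian L2358 phi2358 t x u (- 1) p"
    using assms by blast
  then have "(u$1 - p$1)^2 + (u$2 - h2 x p)^2 \<le> 0"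
    unfolding hamiltonian_2358_eq vector_2 diff_self zero_power2 by (rule gap)
  then have "u$1 = p$1 \<and> u$2 = h2 x p"
    by (simp add: sum_power2_le_zero_iff)
  then show ?thesis
    by (simp add: vec_eq_iff forall_2)
qed

text \<open>
  The definition of an extremal speaks of some gradient; the next two lemmas identify it, for the
  momentum and for the state.
\<close>

lemma GDERIV_hamiltonian_momentum:
  assumes "GDERIV (\<lambda>p. hamiltonian L \<phi> t x u c p) p :> v"
  shows "v = \<phi> t x u"
proof -
  have "((\<lambda>p. hamiltonian L \<phi> t x u c p) has_derivative (\<lambda>h. h \<bullet> \<phi> t x u)) (at p)"
    unfolding hamiltonian_def by (auto intro!: derivative_eq_intros)
  with assms have "(\<lambda>h. h \<bullet> v) = (\<lambda>h. h \<bullet> \<phi> t x u)"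
    unfolding gderiv_def by (rule has_derivative_unique)
  then show ?thesis
    by (metis vector_eq_ldot)
qed

lemma GDERIV_hamiltonian_2358_state:
  assumes "GDERIV (\<lambda>y. hamiltonian L2358 phi2358 t y u c p) x :> w"
  shows "w = vector [u$2 * h2_x1 x p, u$2 * h2_x2 x p, 0, 0, 0, 0, 0, 0]" (is "w = ?w")
proof -
  have "((\<lambda>y. hamiltonian L2358 phi2358 t y u c p) has_derivative (\<lambda>h. h \<bullet> ?w)) (at x)"
    unfolding hamiltonian_def L2358_def inner_phi2358 h2_def
    by (auto intro!: derivative_eq_intros ext
        simp: inner_8 h2_x1_def h2_x2_def field_simps power2_eq_square)
  with assms have "(\<lambda>h. h \<bullet> w) = (\<lambda>h. h \<bullet> ?w)"
    unfolding gderiv_def by (rule has_derivative_unique)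
  then show ?thesis
    by (metis vector_eq_ldot)
qed

lemma extremal_flow:
  assumes "pontryagin_extremal L2358 phi2358 UNIV a b x u (- 1) p"
  shows "AE t in lborel. t \<in> {a..b} \<longrightarrow>
     u t = vector [p t $ 1, h2 (x t) (p t)] \<and>
     (x has_vector_derivative xvel (x t, p t)) (at t within {a..b}) \<and>
     (p has_vector_derivative pvel (x t, p t)) (at t within {a..b})"
proof -
  have "AE t in lborel. t \<in> {a..b} \<longrightarrow>
        (\<exists>v. (GDERIV (\<lambda>q. hamiltonian L2358 phi2358 t (x t) (u t) (- 1) q) (p t) :> v) \<and>
             (x has_vector_derivative v) (at t within {a..b})) \<and>
        (\<exists>w. (GDERIV (\<lambda>y. hamiltonian L2358 phi2358 t y (u t) (- 1) (p t)) (x t) :> w) \<and>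
             (p has_vector_derivative - w) (at t within {a..b})) \<and>
        (\<forall>v\<in>UNIV. hamiltonian L2358 phi2358 t (x t) v (- 1) (p t)
                   \<le> hamiltonian L2358 phi2358 t (x t) (u t) (- 1) (p t))"
    using assms unfolding pontryagin_extremal_def by blast
  then show ?thesis
  proof eventually_elim
    case (elim t)
    show ?case
    proof
      assume "t \<in> {a..b}"
      with elim obtain v w where
        v: "GDERIV (\<lambda>q. hamiltonian L2358 phi2358 t (x t) (u t) (- 1) q) (p t) :> v"
           "(x has_vector_derivative v) (at t within {a..b})" and
        w: "GDERIV (\<lambda>y. hamiltonian L2358 phi2358 t y (u t) (- 1) (p t)) (x t) :> w"
           "(p has_vector_derivative - w) (at t within {a..b})" and
        u: "u t = vector [p t $ 1, h2 (x t) (p t)]"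
        using maximizing_control by blast
      have "v = xvel (x t, p t)"
        using GDERIV_hamiltonian_momentum[OF v(1)] by (simp add: u xvel_def phi2358_def)
      moreover have "- w = pvel (x t, p t)"
        unfolding GDERIV_hamiltonian_2358_state[OF w(1)] u pvel_def
        by (simp add: vec_eq_iff forall_8)
      ultimately show "u t = vector [p t $ 1, h2 (x t) (p t)] \<and>
          (x has_vector_derivative xvel (x t, p t)) (at t within {a..b}) \<and>
          (p has_vector_derivative pvel (x t, p t)) (at t within {a..b})"
        using u v w by simp
    qed
  qed
qed

lemma first_integralI:
  assumes "\<And>z. (F has_derivative F' z) (at z)" and "\<And>z. F' z (xvel z, pvel z) = 0"
  shows "first_integral L2358 phi2358 UNIV a b F"
  unfolding first_integral_def
proof (intro allI impI)
  fix x u p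
  assume ext: "pontryagin_extremal L2358 phi2358 UNIV a b x u (- 1) p"
  show "(\<lambda>t. F (x t, p t)) constant_on {a..b}"
  proof (rule constant_on_derivative_along_AE_flow[OF _ _ continuous_on_xvel continuous_on_pvel])
    show "x piecewise_C1_differentiable_on {a..b}" "p piecewise_C1_differentiable_on {a..b}"
      using ext unfolding pontryagin_extremal_def by blast+
    show "AE t in lborel. t \<in> {a..b} \<longrightarrow>
            (x has_vector_derivative xvel (x t, p t)) (at t within {a..b})"
      using extremal_flow[OF ext] by eventually_elim blast
    show "AE t in lborel. t \<in> {a..b} \<longrightarrow>
            (p has_vector_derivative pvel (x t, p t)) (at t within {a..b})"
      using extremal_flow[OF ext] by eventually_elim blast
  qed (rule assms)+
qed

section \<open>The eight integrals\<close>

text \<open>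
  The differential of \<open>H2358\<close> at \<open>(x, p)\<close> in the direction \<open>(k, q)\<close>. As \<open>h2 x p\<close> is linear in \<open>p\<close>, its
  derivative in the direction \<open>q\<close> is \<open>h2 x q\<close>.
\<close>

definition dH :: "(real^8) \<times> (real^8) \<Rightarrow> (real^8) \<times> (real^8) \<Rightarrow> real" where
  "dH = (\<lambda>(x, p) (k, q). p$1 * q$1 + h2 x p * (h2 x q + h2_x1 x p * k$1 + h2_x2 x p * k$2))"

definition differentials2358 ::
    "((real^8) \<times> (real^8) \<Rightarrow> (real^8) \<times> (real^8) \<Rightarrow> real) list" where
  "differentials2358 =
     [\<lambda>z (k, q). q$3,
      \<lambda>z (k, q). q$4,
      \<lambda>z (k, q). q$5,
      \<lambda>z (k, q). q$6,
      \<lambda>z (k, q). q$7,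
      \<lambda>z (k, q). q$8,
      \<lambda>(x, p) (k, q). q$2 + (x$3 * q$5 + k$3 * p$5) + (x$4 * q$7 + k$4 * p$7)
                          + (x$5 * q$8 + k$5 * p$8),
      dH]"

lemma H2358_eq: "H2358 = (\<lambda>(x, p). 1/2 * (p$1)^2 + 1/2 * (h2 x p)^2)"
  by (simp add: H2358_def h2_def)

lemma h2_has_derivative [derivative_intros]:
  "((\<lambda>z. h2 (fst z) (snd z)) has_derivative
     (\<lambda>h. h2 (fst z) (snd h) + h2_x1 (fst z) (snd z) * fst h $ 1 + h2_x2 (fst z) (snd z) * fst h $ 2)) (at z)"
  unfolding h2_def h2_x1_def h2_x2_def
  by (auto intro!: derivative_eq_intros ext
      simp: algebra_simps add_divide_distrib power2_eq_square power3_eq_cube)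

lemma H2358_has_derivative: "(H2358 has_derivative dH z) (at z)"
  unfolding H2358_eq dH_def case_prod_beta
  by (auto intro!: derivative_eq_intros ext)

lemma length_integrals2358: "length integrals2358 = 8"
  by (simp add: integrals2358_def)

lemma integrals2358_has_derivative:
  assumes "i < 8"
  shows "((integrals2358 ! i) has_derivative (differentials2358 ! i) z) (at z)"
proof -
  have coord: "((\<lambda>(x, p). p $ k) has_derivative (\<lambda>(k', q). q $ k)) (at z)" for k :: 8
    unfolding case_prod_beta by (intro derivative_intros)
  have "((\<lambda>(x, p). p$2 + x$3 * p$5 + x$4 * p$7 + x$5 * p$8) has_derivative
          (differentials2358 ! 6) z) (at z)"
    unfolding differentials2358_def case_prod_beta
    by (auto intro!: derivative_eq_intros)
  moreover have "i = 0 \<or> i = 1 \<or> i = 2 \<or> i = 3 \<or> i = 4 \<or> i = 5 \<or> i = 6 \<or> i = 7"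
    using assms by arith
  ultimately show ?thesis
    by (elim disjE) (simp_all add: integrals2358_def differentials2358_def coord
          H2358_has_derivative)
qed

text \<open>
  For \<open>dH\<close> the terms cancel in pairs: \<open>h2 x (pvel z) = - h2 * h2_x2\<close> against the term of \<open>x$2' = h2\<close>, and
  the term of \<open>p$1' = - h2 * h2_x1\<close> against that of \<open>x$1' = p$1\<close>.
\<close>

lemma differentials2358_flow:
  assumes "i < 8"
  shows "(differentials2358 ! i) z (xvel z, pvel z) = 0"
proof -
  have "i = 0 \<or> i = 1 \<or> i = 2 \<or> i = 3 \<or> i = 4 \<or> i = 5 \<or> i = 6 \<or> i = 7"
    using assms by arith
  moreover obtain x p where "z = (x, p)"
    by (cases z)
  moreover have "h2 x (pvel (x, p)) = - h2 x p * h2_x2 x p"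
    unfolding h2_def[of x "pvel _"] by (simp add: pvel_def)
  ultimately show ?thesis
    by (elim disjE; simp add: differentials2358_def dH_def xvel_def phi2358_def pvel_def)
       (simp_all add: h2_x2_def algebra_simps)
qed

lemma integrals2358_first_integral:
  assumes "F \<in> set integrals2358"
  shows "first_integral L2358 phi2358 UNIV a b F"
proof -
  obtain i where "i < 8" "F = integrals2358 ! i"
    using assms length_integrals2358 by (metis in_set_conv_nth)
  then show ?thesis
    using first_integralI[OF integrals2358_has_derivative differentials2358_flow] by blast
qed

lemma integrals2358_independent: "functionally_independent integrals2358"
  unfolding functionally_independent_def
proof (intro exI conjI ballI allI impI)
  let ?e = "(0, axis 1 1) :: (real^8) \<times> (real^8)"
  let ?U = "- {z. ?e \<bullet> z = 0}"
  show "open ?U"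
    by (simp add: open_Compl closed_hyperplane)
  have "?e \<noteq> 0"
    by (simp add: prod_eq_iff)
  then show "closure ?U = UNIV"
    by (simp add: closure_complement del: Compl_eq)
  fix z :: "(real^8) \<times> (real^8)"
  assume "z \<in> ?U"
  then have p1: "snd z $ 1 \<noteq> 0"
    by (simp add: inner_prod_def inner_axis')
  show "(integrals2358 ! i) differentiable (at z)" if "i < length integrals2358" for i
    using integrals2358_has_derivative that length_integrals2358 differentiable_def by metis
  fix c :: "nat \<Rightarrow> real" and i
  assume c: "\<forall>h. (\<Sum>i<length integrals2358. c i * frechet_derivative (integrals2358 ! i) (at z) h) = 0"
    and i: "i < length integrals2358"
  have sum0: "(\<Sum>i<8. c i * (differentials2358 ! i) z h) = 0" for h
  proof -
    have "(\<Sum>i<8. c i * (differentials2358 ! i) z h)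
        = (\<Sum>i<8. c i * frechet_derivative (integrals2358 ! i) (at z) h)"
      using frechet_derivative_at[OF integrals2358_has_derivative] by (intro sum.cong) auto
    also have "\<dots> = 0"
      using c[rule_format, of h] by (simp add: length_integrals2358)
    finally show ?thesis .
  qed
  note test = sum0[of "(0, axis k 1)" for k :: 8]
  have expand: "(\<Sum>i<8. f i) = f 0 + f 1 + f 2 + f 3 + f 4 + f 5 + f 6 + f 7" for f :: "nat \<Rightarrow> real"
    by (simp add: eval_nat_numeral)
  note eval = expand differentials2358_def dH_def case_prod_beta axis_def h2_def[of _ "vec_lambda _"]
  \<comment> \<open>Triangular solution: only \<open>dH\<close> sees the direction of \<open>\<psi>$1\<close>, and besides it only the seventh
    differential sees that of \<open>\<psi>$2\<close>.\<close>
  have c7: "c 7 = 0"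
    using test[of 1] p1 by (simp add: eval)
  have c6: "c 6 = 0"
    using test[of 2] c7 by (simp add: eval)
  have "c 0 = 0" "c 1 = 0" "c 2 = 0" "c 3 = 0" "c 4 = 0" "c 5 = 0"
    using test[of 3] test[of 4] test[of 5] test[of 6] test[of 7] test[of 8] c6 c7
    by (simp_all add: eval)
  moreover have "i = 0 \<or> i = 1 \<or> i = 2 \<or> i = 3 \<or> i = 4 \<or> i = 5 \<or> i = 6 \<or> i = 7"
    using i length_integrals2358 by arith
  ultimately show "c i = 0"
    using c6 c7 by auto
qed

theorem mainTheorem1:
  fixes a b :: real
  assumes "a < b"
  shows "(\<forall>F\<in>set integrals2358. first_integral L2358 phi2358 UNIV a b F) \<and>
         functionally_independent integrals2358 \<and>
         (\<forall>x u \<psi>. pontryagin_extremal L2358 phi2358 UNIV a b x u (- 1) \<psi> \<longrightarrow>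
            (AE t in lborel. t \<in> {a..b} \<longrightarrow>
               hamiltonian L2358 phi2358 t (x t) (u t) (- 1) (\<psi> t) = H2358 (x t, \<psi> t)))"
proof (intro conjI ballI allI impI)
  fix x u \<psi>
  assume "pontryagin_extremal L2358 phi2358 UNIV a b x u (- 1) \<psi>"
  from extremal_flow[OF this]
  show "AE t in lborel. t \<in> {a..b} \<longrightarrow>
          hamiltonian L2358 phi2358 t (x t) (u t) (- 1) (\<psi> t) = H2358 (x t, \<psi> t)"
    by eventually_elim (simp add: hamiltonian_2358_eq H2358_eq)
qed (simp_all add: integrals2358_first_integral integrals2358_independent)

end
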